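(* Let $n>1$ be an integer with exactly $k$ distinct prime factors, where $k>2$. Then $$g(n)<k^{\,3+3.81\log\log k}.$$
   Context: Jacobsthal's function $g(n)$ is the smallest positive integer $m$ such that for every integer $a$ the set $\{a+1,\dots,a+m\}$ contains an integer coprime to $n$. Here $\log$ is the natural logarithm. *)

theory Defs
  imports Complex_Main "HOL-Computational_Algebra.Primes"
begin

definition jacobsthal :: "nat \<Rightarrow> nat" where
  "jacobsthal n =
     (LEAST m. m > 0 \<and> (\<forall>a::int. \<exists>x\<in>{a + 1..a + int m}. coprime x (int n)))"

(* For n > 0 the set under LEAST is nonempty (it contains n), so the minimum is attained. *)
lemma jacobsthal_exists:
  assumes "n > 0"
  shows "\<exists>m>0. \<forall>a::int. \<exists>x\<in>{a + 1..a + int m}. coprime x (int n)"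
proof (intro exI[of _ n] conjI allI)
  show "n > 0" by fact
  fix a :: int
  let ?x = "a + 1 + (- a) mod int n"
  have bounds: "0 \<le> (- a) mod int n" "(- a) mod int n < int n"
    using assms by simp_all
  have "- a = int n * ((- a) div int n) + (- a) mod int n" by simp
  then have x: "?x = 1 + int n * (- ((- a) div int n))"
    by (simp only: mult_minus_right)
  have "coprime ?x (int n)"
  proof (rule coprimeI)
    fix c assume c: "c dvd ?x" "c dvd int n"
    have "c dvd ?x - int n * (- ((- a) div int n))"
      using c by (meson dvd_diff dvd_mult2)
    then show "is_unit c" unfolding x by simp
  qed
  with bounds show "\<exists>x\<in>{a + 1..a + int n}. coprime x (int n)"
    by (intro bexI[of _ ?x]) auto
qed

end

theory Submission
  imports Defs "HOL-Analysis.Harmonic_Numbers"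
begin

text \<open>
  Let \<open>n\<close> have \<open>k\<close> distinct prime factors, and consider an interval of length \<open>m\<close> all of whose elements share
  a prime factor with \<open>n\<close>; the longest such interval has length one less than the Jacobsthal function.
  Split the prime factors into the \<open>s\<close> smallest, forming \<open>A\<close>, and the rest, forming \<open>B\<close>. Inclusion-exclusion
  over \<open>A\<close> shows that about \<open>m * P\<close> elements are prime to \<open>A\<close>, where \<open>P\<close> is the product of \<open>1 - 1 / q\<close>
  over \<open>A\<close>, and each \<open>q\<close> in \<open>B\<close> divides about \<open>m * P / q\<close> of them. If the reciprocals of the primes in
  \<open>B\<close> sum to less than 1, then \<open>B\<close> cannot account for all of them unless \<open>m\<close> is bounded in terms of
  the number of divisors used (\<open>sieve_inequality\<close>).

  The choice of \<open>s\<close> rests on a Chebyshev bound: the \<open>i\<close>-th prime is at least \<open>i * ln i / ln 4\<close>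
  (\<open>card_power_card_le_4_power_Max\<close>, from the bound \<open>4 ^ x\<close> for the product of the primes up to \<open>x\<close>).
  So the reciprocals of the primes after the \<open>s\<close>-th sum to at most \<open>ln 4 * ln (ln k / ln s)\<close>, and for
  \<open>s\<close> at least the square root of \<open>k\<close> this is at most \<open>ln 4 * ln 2 < 1\<close>
  (\<open>sum_reciprocal_bound_le_31_32\<close>).

  For \<open>k < 1024\<close> the full inclusion-exclusion over \<open>A\<close> with its \<open>2 ^ s\<close> terms is good enough
  (\<open>jacobsthal_le_full\<close>, \<open>jacobsthal_small\<close>). For larger \<open>k\<close> the divisors are truncated, as in Brun's pure
  sieve, to at most \<open>v\<close> prime factors. With \<open>S\<close> the sum of the reciprocals over \<open>A\<close>, a value of \<open>v\<close> near
  \<open>4 * S\<close> suffices; since \<open>S\<close> is at most \<open>ln 4 * ln (ln k)\<close> up to a constant, the roughly \<open>k * s ^ v\<close> terms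
  give an exponent of \<open>k\<close> that grows like \<open>2 * ln 4 * ln (ln k)\<close>, below \<open>3.81 * ln (ln k)\<close>
  (\<open>jacobsthal_le_truncated\<close>, \<open>jacobsthal_large\<close>). Splitting at the square root is what
  allows crude prime bounds here: the pure sieve over all \<open>k\<close> primes would give an exponent
  about twice as large.
\<close>

section \<open>Truncated inclusion-exclusion\<close>

definition small_subsets :: "nat \<Rightarrow> 'a set \<Rightarrow> 'a set set" where
  "small_subsets v X = {D. D \<subseteq> X \<and> card D \<le> v}"

lemma finite_small_subsets [simp]: "finite X \<Longrightarrow> finite (small_subsets v X)"
  by (rule finite_subset[of _ "Pow X"]) (auto simp: small_subsets_def)

lemma small_subsets_empty [simp]: "small_subsets v {} = {{}}"
  by (auto simp: small_subsets_def)

lemma small_subsets_0 [simp]: "finite X \<Longrightarrow> small_subsets 0 X = {{}}"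
  by (auto simp: small_subsets_def finite_subset card_eq_0_iff)

text \<open>Subsets that contain the new element use up one unit of the size bound. This recursion
  drives both the Bonferroni inequalities and the count of the terms.\<close>
lemma sum_small_subsets_insert:
  assumes "finite X" "a \<notin> X"
  shows "sum f (small_subsets (Suc v) (insert a X)) =
         sum f (small_subsets (Suc v) X) + (\<Sum>D\<in>small_subsets v X. f (insert a D))"
proof -
  have split: "small_subsets (Suc v) (insert a X) =
      small_subsets (Suc v) X \<union> insert a ` small_subsets v X"
  proof (intro subset_antisym subsetI)
    fix D assume D: "D \<in> small_subsets (Suc v) (insert a X)"
    have fD: "finite D" using D assms(1) by (auto simp: small_subsets_def intro: finite_subset)
    show "D \<in> small_subsets (Suc v) X \<union> insert a ` small_subsets v X"
    proof (cases "a \<in> D")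
      case True
      have "card (D - {a}) \<le> v"
        using D fD True by (auto simp: small_subsets_def card_Diff_singleton)
      then have "D - {a} \<in> small_subsets v X" using D by (auto simp: small_subsets_def)
      moreover have "D = insert a (D - {a})" using True by auto
      ultimately show ?thesis by blast
    next
      case False
      then show ?thesis using D by (auto simp: small_subsets_def)
    qed
  next
    fix D assume D: "D \<in> small_subsets (Suc v) X \<union> insert a ` small_subsets v X"
    then show "D \<in> small_subsets (Suc v) (insert a X)"
    proof
      assume "D \<in> insert a ` small_subsets v X"
      then obtain D' where "D = insert a D'" "D' \<subseteq> X" "card D' \<le> v"
        by (auto simp: small_subsets_def)
      moreover have "finite D'" using calculation assms(1) finite_subset by blast
      ultimately show ?thesis using assms(2)
        by (auto simp: small_subsets_def card_insert_if)
    qed (auto simp: small_subsets_def)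
  qed
  have inj: "inj_on (insert a) (small_subsets v X)"
    using assms(2) by (auto simp: inj_on_def small_subsets_def)
  have "small_subsets (Suc v) X \<inter> insert a ` small_subsets v X = {}"
    using assms(2) by (auto simp: small_subsets_def)
  then show ?thesis
    unfolding split using assms(1) inj
    by (subst sum.union_disjoint) (auto simp: sum.reindex)
qed

text \<open>The Moebius sum over the divisors, with at most \<open>v\<close> prime factors, of an integer
  whose relevant prime factors form the set \<open>X\<close>. Untruncated it is the indicator of \<open>X = {}\<close>.\<close>
definition sieve_weight :: "nat \<Rightarrow> 'a set \<Rightarrow> real" where
  "sieve_weight v X = (\<Sum>D\<in>small_subsets v X. (-1) ^ card D)"

lemma sieve_weight_insert:
  assumes "finite X" "a \<notin> X"
  shows "sieve_weight (Suc v) (insert a X) = sieve_weight (Suc v) X - sieve_weight v X"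
proof -
  have "(\<Sum>D\<in>small_subsets v X. (-1) ^ card (insert a D)) = (\<Sum>D\<in>small_subsets v X. - ((-1::real) ^ card D))"
  proof (rule sum.cong[OF refl])
    fix D assume "D \<in> small_subsets v X"
    then have "finite D" "a \<notin> D" using assms finite_subset by (auto simp: small_subsets_def)
    then show "(-1::real) ^ card (insert a D) = - ((-1) ^ card D)" by simp
  qed
  then show ?thesis
    unfolding sieve_weight_def sum_small_subsets_insert[OF assms] by (simp add: sum_negf)
qed

text \<open>The value is \<open>(-1) ^ v\<close> times the binomial coefficient of \<open>card X - 1\<close> over \<open>v\<close>. For the sign
  alone no binomials are needed: in the recursion the two summands already have the same sign.\<close>
lemma bonferroni:
  assumes "finite X" "X \<noteq> {}"
  shows "0 \<le> (-1) ^ v * sieve_weight v X"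
  using assms
proof (induction X arbitrary: v rule: finite_ne_induct)
  case (singleton a)
  show ?case
  proof (cases v)
    case 0
    then show ?thesis by (simp add: sieve_weight_def)
  next
    case (Suc w)
    have "sieve_weight (Suc w) {a} = 0"
      using sieve_weight_insert[of "{}" a w] by (simp add: sieve_weight_def)
    then show ?thesis by (simp add: Suc)
  qed
next
  case (insert a X)
  show ?case
  proof (cases v)
    case 0
    then show ?thesis using insert by (simp add: sieve_weight_def)
  next
    case (Suc w)
    show ?thesis
      using insert.IH[of "Suc w"] insert.IH[of w] insert.hyps
      by (simp add: Suc sieve_weight_insert algebra_simps)
  qed
qed

lemma sieve_weight_empty [simp]: "sieve_weight v {} = 1"
  by (simp add: sieve_weight_def)

lemma sieve_weight_even:
  assumes "finite X" "even v"
  shows "of_bool (X = {}) \<le> sieve_weight v X"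
  using bonferroni[of X v] assms by (cases "X = {}") auto

lemma sieve_weight_odd:
  assumes "finite X" "odd v"
  shows "sieve_weight v X \<le> of_bool (X = {})"
  using bonferroni[of X v] assms by (cases "X = {}") auto

lemma card_small_subsets_le:
  assumes "finite X"
  shows "card (small_subsets v X) \<le> (card X + 1) ^ v"
  using assms
proof (induction X arbitrary: v rule: finite_induct)
  case (insert a X)
  show ?case
  proof (cases v)
    case (Suc w)
    have "card (small_subsets (Suc w) (insert a X)) =
        card (small_subsets (Suc w) X) + card (small_subsets w X)"
      using sum_small_subsets_insert[OF insert.hyps, of "\<lambda>_. 1::nat" w] by simp
    also have "\<dots> \<le> (card X + 1) ^ Suc w + (card X + 1) ^ w"
      by (intro add_mono insert.IH)
    also have "\<dots> = (card X + 2) * (card X + 1) ^ w" by (simp add: algebra_simps)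
    also have "\<dots> \<le> (card X + 2) * (card X + 2) ^ w"
      by (intro mult_left_mono power_mono) auto
    finally show ?thesis using insert.hyps by (simp add: Suc)
  qed (use insert in simp)
qed simp

lemma small_subsets_all:
  assumes "finite X" "card X \<le> v"
  shows "small_subsets v X = Pow X"
  using assms by (auto simp: small_subsets_def intro: order_trans[OF card_mono])

section \<open>Counting the integers of an interval that no small prime divides\<close>

definition interval :: "int \<Rightarrow> nat \<Rightarrow> int set" where
  "interval a m = {a + 1..a + int m}"

lemma finite_interval [simp]: "finite (interval a m)"
  by (simp add: interval_def)

lemma card_multiples_interval:
  assumes "d > 0"
  shows "int (card {x\<in>interval a m. int d dvd x}) = (a + int m) div int d - a div int d"
proof (induction m)
  case 0
  then show ?case by (simp add: interval_def)
next
  case (Suc m)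
  let ?y = "a + int m"
  have "interval a (Suc m) = insert (?y + 1) (interval a m)"
    by (auto simp: interval_def)
  then have *: "{x\<in>interval a (Suc m). int d dvd x} =
      (if int d dvd ?y + 1 then insert (?y + 1) {x\<in>interval a m. int d dvd x}
       else {x\<in>interval a m. int d dvd x})" by auto
  have notin: "?y + 1 \<notin> {x\<in>interval a m. int d dvd x}" by (simp add: interval_def)
  have step: "(?y + 1) div int d = ?y div int d + (if int d dvd ?y + 1 then 1 else 0)"
  proof -
    let ?q = "?y div int d" and ?r = "?y mod int d"
    have y: "?y + 1 = (?r + 1) + ?q * int d"
      by (simp add: algebra_simps)
    have r: "0 \<le> ?r" "?r < int d" using assms by simp_all
    show ?thesis
    proof (cases "?r + 1 = int d")
      case True
      then have "?y + 1 = (?q + 1) * int d" using y by (simp add: algebra_simps)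
      then show ?thesis using assms by simp
    next
      case False
      then have "(?r + 1) div int d = 0" "(?r + 1) mod int d = ?r + 1" using r by simp_all
      moreover have "\<not> int d dvd ?r + 1" using False r by (simp add: zdvd_not_zless)
      moreover have "int d dvd ?y + 1 \<longleftrightarrow> int d dvd ?r + 1"
        by (metis y dvd_add_times_triv_right_iff)
      moreover have "(?y + 1) div int d = (?r + 1) div int d + ?q"
        using div_mult_self1[of "int d" "?r + 1" ?q] assms unfolding y[symmetric] by simp
      ultimately show ?thesis by simp
    qed
  qed
  have eq: "a + int (Suc m) = ?y + 1" by simp
  show ?case
    using Suc step notin unfolding * eq by (auto simp: card_insert_if)
qed

lemma card_multiples_interval_approx:
  assumes "d > 0"
  shows "\<bar>real (card {x\<in>interval a m. int d dvd x}) - real m / real d\<bar> \<le> 1"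
proof -
  have 1: "real (card {x\<in>interval a m. int d dvd x}) =
      of_int ((a + int m) div int d) - of_int (a div int d)"
    using arg_cong[OF card_multiples_interval[OF assms, of a m], of real_of_int] by simp
  have fl: "of_int (y div int d) = (real_of_int \<lfloor>real_of_int y / real d\<rfloor>)" for y
    using floor_divide_of_int_eq[of y "int d", where ?'a = real] by simp
  have "real_of_int (a + int m) / real d = real_of_int a / real d + real m / real d"
    by (simp add: add_divide_distrib)
  then show ?thesis unfolding 1 fl by linarith
qed

lemma dvd_prod_primes_iff:
  assumes "finite D" "\<And>p. p \<in> D \<Longrightarrow> prime p"
  shows "int (\<Prod>D) dvd x \<longleftrightarrow> (\<forall>p\<in>D. int p dvd x)"
  using assms
proof (induction D rule: finite_induct)
  case (insert p D)
  have "coprime p (\<Prod>D)"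
  proof (rule prod_coprime_right)
    fix q assume "q \<in> D"
    then show "coprime p q" using insert by (intro primes_coprime) auto
  qed
  then have "coprime (int p) (int (\<Prod>D))" by (simp only: coprime_int_iff)
  then have "int p * int (\<Prod>D) dvd x \<longleftrightarrow> int p dvd x \<and> int (\<Prod>D) dvd x"
    by (metis divides_mult dvd_mult_left dvd_mult_right)
  then show ?case using insert by simp
qed simp

definition main_term :: "nat \<Rightarrow> nat set \<Rightarrow> real" where
  "main_term v A = (\<Sum>D\<in>small_subsets v A. (-1) ^ card D / real (\<Prod>D))"

text \<open>Swapping the two sums, every divisor contributes its density with an error of at most one, so
  the total error is the number of divisors used. The extra factor \<open>b\<close> is independent of them;
  it is 1 when the whole interval is counted and one of the large primes otherwise.\<close>
lemma sum_sieve_weight_approx: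
  assumes A: "finite A" "\<And>p. p \<in> A \<Longrightarrow> prime p"
    and b: "b = 1 \<or> prime b" "b \<notin> A"
  shows "\<bar>(\<Sum>x\<in>{x\<in>interval a m. int b dvd x}. sieve_weight v {p\<in>A. int p dvd x})
          - real m / real b * main_term v A\<bar> \<le> real (card (small_subsets v A))"
proof -
  let ?S = "small_subsets v A" and ?I = "{x\<in>interval a m. int b dvd x}"
  let ?N = "\<lambda>D. real (card {x\<in>interval a m. int (b * \<Prod>D) dvd x})"
  have fin: "finite ?S" using A by simp
  have Dfin: "finite D" "\<And>p. p \<in> D \<Longrightarrow> prime p" if "D \<in> ?S" for D
    using that A finite_subset by (auto simp: small_subsets_def)
  have "sieve_weight v {p\<in>A. int p dvd x} =
      (\<Sum>D\<in>?S. if \<forall>p\<in>D. int p dvd x then (-1) ^ card D else 0)" for x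
    unfolding sieve_weight_def using fin
    by (subst sum.inter_filter[symmetric]) (auto intro!: sum.cong simp: small_subsets_def)
  then have "(\<Sum>x\<in>?I. sieve_weight v {p\<in>A. int p dvd x}) =
      (\<Sum>D\<in>?S. \<Sum>x\<in>?I. if \<forall>p\<in>D. int p dvd x then (-1) ^ card D else 0)"
    by (simp add: sum.swap[of _ ?S])
  also have "\<dots> = (\<Sum>D\<in>?S. (-1) ^ card D * ?N D)"
  proof (rule sum.cong[OF refl])
    fix D assume D: "D \<in> ?S"
    have "{x\<in>interval a m. int (b * \<Prod>D) dvd x} = {x\<in>?I. \<forall>p\<in>D. int p dvd x}"
    proof -
      have "coprime b (\<Prod>D)"
      proof (rule prod_coprime_right)
        fix q assume "q \<in> D"
        then have "prime q" "q \<noteq> b" using D b A by (auto simp: small_subsets_def)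
        then show "coprime b q" using b(1) primes_coprime by auto
      qed
      then have "coprime (int b) (int (\<Prod>D))" by (simp only: coprime_int_iff)
      then have "int (b * \<Prod>D) dvd x \<longleftrightarrow> int b dvd x \<and> int (\<Prod>D) dvd x" for x
        unfolding of_nat_mult by (metis divides_mult dvd_mult_left dvd_mult_right)
      then show ?thesis using dvd_prod_primes_iff[OF Dfin[OF D]] by auto
    qed
    then show "(\<Sum>x\<in>?I. if \<forall>p\<in>D. int p dvd x then (-1) ^ card D else 0) = (-1) ^ card D * ?N D"
      by (subst sum.inter_filter[symmetric]) (auto simp: mult.commute)
  qed
  finally have "(\<Sum>x\<in>?I. sieve_weight v {p\<in>A. int p dvd x}) - real m / real b * main_term v A
      = (\<Sum>D\<in>?S. (-1) ^ card D * (?N D - real m / real (b * \<Prod>D)))"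
    by (simp add: main_term_def sum_distrib_left sum_subtractf algebra_simps)
  also have "\<bar>\<dots>\<bar> \<le> (\<Sum>D\<in>?S. 1)"
  proof (rule order_trans[OF sum_abs], rule sum_mono)
    fix D assume D: "D \<in> ?S"
    have "b * \<Prod>D > 0"
      using Dfin[OF D] b by (auto intro!: prod_pos dest: prime_gt_0_nat)
    then show "\<bar>(-1) ^ card D * (?N D - real m / real (b * \<Prod>D))\<bar> \<le> 1"
      using card_multiples_interval_approx[of "b * \<Prod>D" a m]
      by (simp only: abs_mult power_abs abs_minus_cancel abs_one power_one mult_1_left)
  qed
  finally show ?thesis by simp
qed

section \<open>The sieve inequality\<close>

definition tail_term :: "nat \<Rightarrow> nat set \<Rightarrow> real" where
  "tail_term v A = (\<Sum>D\<in>Pow A - small_subsets v A. 1 / real (\<Prod>D))"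

lemma tail_term_nonneg: "0 \<le> tail_term v A"
  unfolding tail_term_def by (intro sum_nonneg) (simp add: prod_nonneg)

lemma tail_term_mono:
  assumes "finite A" "v \<le> w"
  shows "tail_term w A \<le> tail_term v A"
  unfolding tail_term_def using assms
  by (intro sum_mono2) (auto simp: small_subsets_def prod_nonneg)

lemma tail_term_eq_0:
  assumes "finite A" "card A \<le> v"
  shows "tail_term v A = 0"
  by (simp add: tail_term_def small_subsets_all[OF assms])

lemma main_term_approx:
  assumes "finite A"
  shows "\<bar>main_term v A - (\<Prod>q\<in>A. 1 - 1 / real q)\<bar> \<le> tail_term v A"
proof -
  let ?g = "\<lambda>D. (-1) ^ card D / real (\<Prod>D)"
  have "(\<Prod>q\<in>A. 1 - 1 / real q) = (\<Prod>q\<in>A. (- 1 / real q) + 1)"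
    by (intro prod.cong) auto
  also have "\<dots> = sum ?g (Pow A)"
    unfolding prod_add[OF assms]
    by (intro sum.cong refl) (simp add: prod_uminus prod_dividef)
  also have "\<dots> = sum ?g (Pow A - small_subsets v A) + main_term v A"
    unfolding main_term_def using assms
    by (intro sum.subset_diff) (auto simp: small_subsets_def)
  finally have "\<bar>main_term v A - (\<Prod>q\<in>A. 1 - 1 / real q)\<bar>
      = \<bar>sum ?g (Pow A - small_subsets v A)\<bar>" by simp
  also have "\<dots> \<le> (\<Sum>D\<in>Pow A - small_subsets v A. \<bar>?g D\<bar>)" by (rule sum_abs)
  also have "\<dots> = tail_term v A"
    unfolding tail_term_def
    by (intro sum.cong refl) (simp add: abs_mult power_abs abs_prod)
  finally show ?thesis .
qed

text \<open>Rankin's trick: since the omitted divisors have more than \<open>v\<close> prime factors, weighting each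
  prime factor by 4 gains \<open>4 ^ (v + 1)\<close>, and the full weighted sum is an Euler product. Any
  constant weight above 1 would give the same shape of bound; 4 is close to optimal here and matches the
  powers of 4 elsewhere.\<close>
lemma tail_term_le:
  assumes "finite A" "\<And>q. q \<in> A \<Longrightarrow> q > 0"
  shows "tail_term v A \<le> exp (4 * (\<Sum>q\<in>A. 1 / real q)) / 4 ^ (v + 1)"
proof -
  have "tail_term v A \<le> (\<Sum>D\<in>Pow A - small_subsets v A. 4 ^ card D / real (\<Prod>D) / 4 ^ (v + 1))"
    unfolding tail_term_def
  proof (rule sum_mono)
    fix D assume D: "D \<in> Pow A - small_subsets v A"
    then have "v + 1 \<le> card D" by (auto simp: small_subsets_def)
    then have "(4::real) ^ (v + 1) \<le> 4 ^ card D" by (intro power_increasing) auto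
    moreover have "\<Prod>D > 0" using D assms(2) by (intro prod_pos) auto
    ultimately show "1 / real (\<Prod>D) \<le> 4 ^ card D / real (\<Prod>D) / 4 ^ (v + 1)"
      by (simp add: field_simps del: of_nat_prod power_Suc)
  qed
  also have "\<dots> \<le> (\<Sum>D\<in>Pow A. 4 ^ card D / real (\<Prod>D) / 4 ^ (v + 1))"
    using assms(1) by (intro sum_mono2) (auto simp: prod_nonneg)
  also have "\<dots> = (\<Sum>D\<in>Pow A. 4 ^ card D / real (\<Prod>D)) / 4 ^ (v + 1)"
    by (simp add: sum_divide_distrib)
  also have "(\<Sum>D\<in>Pow A. 4 ^ card D / real (\<Prod>D)) = (\<Prod>q\<in>A. 4 / real q + 1)"
    unfolding prod_add[OF assms(1)] by (intro sum.cong refl) (simp add: prod_dividef)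
  also have "(\<Prod>q\<in>A. 4 / real q + 1) \<le> (\<Prod>q\<in>A. exp (4 / real q))"
    by (intro prod_mono) (auto simp: add.commute)
  also have "\<dots> = exp (4 * (\<Sum>q\<in>A. 1 / real q))"
    using assms(1) by (simp add: exp_sum sum_distrib_left)
  finally show ?thesis by (simp add: divide_right_mono)
qed

text \<open>Every integer of a covered interval that no prime of \<open>A\<close> divides is divisible by some prime
  of \<open>B\<close>. So a lower bound for the number of the former is at most the sum over \<open>B\<close> of upper bounds
  for the multiples of each \<open>b\<close>. The lower bound needs an odd truncation and the upper ones an even
  truncation; taking \<open>v + 1\<close> and \<open>v\<close> makes the two error terms comparable in size.
  Expensive inclusion-exclusion is thus confined to \<open>A\<close>, and each prime of \<open>B\<close> costs only its
  reciprocal in the main term.\<close>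
lemma sieve_inequality:
  fixes A B :: "nat set"
  assumes fin: "finite A" "finite B" and disj: "A \<inter> B = {}"
    and primes: "\<And>q. q \<in> A \<union> B \<Longrightarrow> prime q"
    and "even v"
    and le1: "(\<Sum>q\<in>B. 1 / real q) \<le> 1"
    and covered: "\<And>x. x \<in> interval a m \<Longrightarrow> \<exists>q\<in>A \<union> B. int q dvd x"
  shows "real m * ((\<Prod>q\<in>A. 1 - 1 / real q) * (1 - (\<Sum>q\<in>B. 1 / real q)) - 2 * tail_term v A)
    \<le> real (card (small_subsets (Suc v) A)) + real (card B) * real (card (small_subsets v A))"
proof -
  define P where "P = (\<Prod>q\<in>A. 1 - 1 / real q)"
  define c where "c = (\<Sum>q\<in>B. 1 / real q)"
  define T where "T = tail_term v A"
  let ?E = "\<lambda>v. real (card (small_subsets v A))"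
  let ?W = "\<lambda>v x. sieve_weight v {p\<in>A. int p dvd x}"
  let ?M = "\<lambda>b. {x\<in>interval a m. int b dvd x}"
  have c: "0 \<le> c" "c \<le> 1" using le1 by (auto simp: c_def sum_nonneg)
  have Tnn: "0 \<le> T" by (simp add: T_def tail_term_nonneg)
  have "real m * (P - T) - ?E (Suc v) \<le> real m * main_term (Suc v) A - ?E (Suc v)"
    using main_term_approx[OF fin(1), of "Suc v"] tail_term_mono[OF fin(1), of v "Suc v"]
    by (intro diff_right_mono mult_left_mono) (auto simp: P_def T_def)
  also have "\<dots> \<le> (\<Sum>x\<in>interval a m. ?W (Suc v) x)"
  proof -
    have "1 \<notin> A" using primes[of 1] by auto
    then show ?thesis
      using sum_sieve_weight_approx[of A 1 "Suc v" a m] fin primes by (auto simp: abs_le_iff)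
  qed
  also have "\<dots> \<le> (\<Sum>x\<in>interval a m. \<Sum>b\<in>B. if int b dvd x then ?W v x else 0)"
  proof (rule sum_mono)
    fix x assume x: "x \<in> interval a m"
    let ?X = "{p\<in>A. int p dvd x}"
    have finX: "finite ?X" using fin by simp
    have nn: "0 \<le> ?W v x" and ge1: "?X = {} \<Longrightarrow> 1 \<le> ?W v x"
      using sieve_weight_even[OF finX \<open>even v\<close>] by (auto intro: order_trans[rotated])
    have rhs: "0 \<le> (\<Sum>b\<in>B. if int b dvd x then ?W v x else 0)"
      using nn by (intro sum_nonneg) auto
    have odd: "?W (Suc v) x \<le> of_bool (?X = {})"
      using sieve_weight_odd[OF finX, of "Suc v"] \<open>even v\<close> by simp
    show "?W (Suc v) x \<le> (\<Sum>b\<in>B. if int b dvd x then ?W v x else 0)"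
    proof (cases "?X = {}")
      case True
      then obtain b where b: "b \<in> B" "int b dvd x" using covered[OF x] by blast
      have "?W (Suc v) x \<le> 1" by (rule order_trans[OF odd]) simp
      also have "1 \<le> (if int b dvd x then ?W v x else 0)" using ge1[OF True] b by simp
      also have "\<dots> \<le> (\<Sum>b\<in>B. if int b dvd x then ?W v x else 0)"
        using b fin nn by (intro member_le_sum) auto
      finally show ?thesis .
    next
      case False
      with odd have "?W (Suc v) x \<le> 0" by (simp only: of_bool_def if_False)
      then show ?thesis using rhs by linarith
    qed
  qed
  also have "\<dots> = (\<Sum>b\<in>B. \<Sum>x\<in>?M b. ?W v x)"
    by (subst sum.swap) (simp add: sum.inter_filter)
  also have "\<dots> \<le> (\<Sum>b\<in>B. real m * (P + T) * (1 / real b) + ?E v)"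
  proof (rule sum_mono)
    fix b assume b: "b \<in> B"
    have "main_term v A \<le> P + T"
      using main_term_approx[OF fin(1), of v] by (auto simp: P_def T_def)
    then have "real m / real b * main_term v A \<le> real m / real b * (P + T)"
      by (intro mult_left_mono) auto
    moreover have "b \<notin> A" "prime b" using b disj primes by auto
    ultimately show "(\<Sum>x\<in>?M b. ?W v x) \<le> real m * (P + T) * (1 / real b) + ?E v"
      using sum_sieve_weight_approx[of A b v a m] fin primes by (auto simp: abs_le_iff)
  qed
  also have "\<dots> = real m * (P + T) * c + real (card B) * ?E v"
    by (simp only: sum.distrib sum_distrib_left[symmetric] c_def) simp
  finally have "real m * (P * (1 - c) - (1 + c) * T) \<le> ?E (Suc v) + real (card B) * ?E v"
    by (simp add: algebra_simps)
  moreover have "real m * (P * (1 - c) - 2 * T) \<le> real m * (P * (1 - c) - (1 + c) * T)"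
    using c Tnn by (intro mult_left_mono diff_left_mono mult_right_mono) auto
  ultimately show ?thesis unfolding P_def c_def T_def by linarith
qed

section \<open>Jacobsthal gaps and Euler products\<close>

lemma jacobsthal_gap:
  assumes "n > 0"
  obtains a where "\<And>x. x \<in> interval a (jacobsthal n - 1) \<Longrightarrow> \<exists>q\<in>prime_factors n. int q dvd x"
proof -
  let ?m = "jacobsthal n - 1"
  have "\<exists>a::int. \<forall>x\<in>interval a ?m. \<not> coprime x (int n)"
  proof (cases "?m = 0")
    case True
    then show ?thesis by (simp add: interval_def)
  next
    case False
    have "jacobsthal n > 0"
      unfolding jacobsthal_def using LeastI_ex[OF jacobsthal_exists[OF assms]] by simp
    then have "?m < jacobsthal n" by simp
    from not_less_Least[OF this[unfolded jacobsthal_def]] False show ?thesis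
      unfolding jacobsthal_def interval_def by auto
  qed
  then obtain a where a: "\<And>x. x \<in> interval a ?m \<Longrightarrow> \<not> coprime x (int n)" by blast
  show thesis
  proof (rule that)
    fix x assume "x \<in> interval a ?m"
    then have "gcd (nat \<bar>x\<bar>) n \<noteq> 1"
      using a by (metis coprime_iff_gcd_eq_1 gcd_int_def nat_int abs_of_nat of_nat_1)
    then obtain q where q: "prime q" "q dvd gcd (nat \<bar>x\<bar>) n"
      using prime_factor_nat by blast
    then show "\<exists>q\<in>prime_factors n. int q dvd x"
      using assms q(1) dvd_trans[OF q(2) gcd_dvd1] dvd_trans[OF q(2) gcd_dvd2]
      by (intro bexI[of _ q]) (simp_all add: prime_factors_dvd)
  qed
qed

text \<open>Convexity: \<open>4 powr (- x)\<close> and \<open>1 - x\<close> agree at 0 and at 1/2.\<close>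
lemma prod_ge_4_powr:
  fixes A :: "nat set"
  assumes "finite A" "\<And>q. q \<in> A \<Longrightarrow> q \<ge> 2"
  shows "4 powr (- (\<Sum>q\<in>A. 1 / real q)) \<le> (\<Prod>q\<in>A. 1 - 1 / real q)"
proof -
  have *: "4 powr (-x) \<le> 1 - x" if "0 \<le> x" "x \<le> 1/2" for x :: real
  proof -
    have "exp ((1 - 2 * x) * 0 + 2 * x * (- ln 2)) \<le> (1 - 2 * x) * exp 0 + 2 * x * exp (- ln (2::real))"
      using convex_onD[OF exp_convex, of "2 * x" 0 "- ln 2"] that by simp
    moreover have "exp (- ln 2) = (1/2::real)" by (simp add: exp_minus)
    moreover have "ln 4 = 2 * ln (2::real)" using ln_realpow[of "2::real" 2] by simp
    ultimately show ?thesis by (simp add: powr_def algebra_simps)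
  qed
  have "4 powr (- (\<Sum>q\<in>A. 1 / real q)) = (\<Prod>q\<in>A. 4 powr (- (1 / real q)))"
    using assms(1) by (simp add: powr_def exp_sum sum_distrib_right sum_negf [symmetric])
  also have "\<dots> \<le> (\<Prod>q\<in>A. 1 - 1 / real q)"
  proof (intro prod_mono conjI)
    fix q assume "q \<in> A"
    then show "4 powr (- (1 / real q)) \<le> 1 - 1 / real q"
      using assms(2)[of q] by (intro *) (auto simp: field_simps)
  qed simp
  finally show ?thesis .
qed

section \<open>A Chebyshev bound for arbitrary finite sets of primes\<close>

lemma binomial_odd_le: "(2 * m + 1) choose m \<le> 4 ^ m"
proof -
  have sym: "(2 * m + 1) choose (m + 1) = (2 * m + 1) choose m"
    using binomial_symmetric[of "m + 1" "2 * m + 1"] by simp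
  have "(\<Sum>k\<in>{m, m + 1}. (2 * m + 1) choose k) \<le> (\<Sum>k\<le>2 * m + 1. (2 * m + 1) choose k)"
    by (intro sum_mono2) auto
  also have "\<dots> = 2 * 4 ^ m"
    unfolding choose_row_sum by (simp add: power_mult)
  finally show ?thesis using sym by simp
qed

text \<open>Erdos's argument: the primes strictly between \<open>m + 1\<close> and \<open>2 * m + 2\<close> all divide the binomial
  coefficient of \<open>2 * m + 1\<close> over \<open>m\<close>.\<close>
lemma primorial_le: "\<Prod>{p. prime p \<and> p \<le> n} \<le> (4::nat) ^ n"
proof (induction n rule: less_induct)
  case (less n)
  show ?case
  proof (cases "n \<le> 2")
    case True
    have "{p::nat. prime p \<and> p \<le> n} \<subseteq> {2}"
      using True by (auto dest: prime_ge_2_nat)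
    then have "{p::nat. prime p \<and> p \<le> n} = {} \<or> {p::nat. prime p \<and> p \<le> n} = {2}" by blast
    then show ?thesis
    proof
      assume *: "{p::nat. prime p \<and> p \<le> n} = {2}"
      then have "n \<ge> 2" by auto
      then have "(4::nat) ^ 2 \<le> 4 ^ n" by (intro power_increasing) auto
      then show ?thesis unfolding * by simp
    qed (simp del: Collect_empty_eq)
  next
    case n: False
    show ?thesis
    proof (cases "even n")
      case True
      then have "\<not> prime n" using n prime_odd_nat[of n] by auto
      then have "{p. prime p \<and> p \<le> n} = {p. prime p \<and> p \<le> n - 1}"
        by (auto simp: le_less)
      then have "\<Prod>{p. prime p \<and> p \<le> n} \<le> 4 ^ (n - 1)" using less[of "n - 1"] n by simp
      also have "\<dots> \<le> 4 ^ n" by (intro power_increasing) auto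
      finally show ?thesis .
    next
      case False
      then obtain m where m: "n = 2 * m + 1" by (auto elim: oddE)
      with n have "m \<ge> 1" by simp
      let ?D = "{p. prime p \<and> m + 1 < p \<and> p \<le> n}"
      have finD: "finite ?D" by (rule finite_subset[of _ "{..n}"]) auto
      have "p dvd n choose m" if "p \<in> ?D" for p
      proof -
        have p: "prime p" "m + 1 < p" "p \<le> n" using that by auto
        have "fact m * fact (n - m) * (n choose m) = (fact n :: nat)"
          by (rule binomial_fact_lemma) (simp add: m)
        moreover have "p dvd fact n" using p by (simp add: prime_dvd_fact_iff)
        moreover have "\<not> p dvd fact m" "\<not> p dvd fact (n - m)"
          using p m by (simp_all add: prime_dvd_fact_iff[OF p(1)] del: fact_Suc)
        ultimately show ?thesis using p(1) by (metis prime_dvd_mult_iff)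
      qed
      then have "int (\<Prod>?D) dvd int (n choose m)"
        by (subst dvd_prod_primes_iff[OF finD]) auto
      then have "\<Prod>?D dvd n choose m" by (simp only: int_dvd_int_iff)
      then have "\<Prod>?D \<le> n choose m"
        by (rule dvd_imp_le) (simp add: m)
      also have "\<dots> \<le> 4 ^ m" unfolding m by (rule binomial_odd_le)
      finally have D: "\<Prod>?D \<le> 4 ^ m" .
      have U: "{p. prime p \<and> p \<le> n} = {p. prime p \<and> p \<le> m + 1} \<union> ?D"
        using m by auto
      have "finite {p::nat. prime p \<and> p \<le> m + 1}"
        by (rule finite_subset[of _ "{..m + 1}"]) auto
      then have "\<Prod>{p. prime p \<and> p \<le> n} = \<Prod>{p. prime p \<and> p \<le> m + 1} * \<Prod>?D"
        using finD by (subst U, intro prod.union_disjoint) auto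
      also have "\<dots> \<le> 4 ^ (m + 1) * 4 ^ m"
        using less[of "m + 1"] m \<open>m \<ge> 1\<close> D by (intro mult_mono) auto
      also have "\<dots> = 4 ^ n" by (simp add: m flip: power_add)
      finally show ?thesis .
    qed
  qed
qed

lemma card_primes_less_Max:
  fixes Q :: "nat set"
  assumes "finite Q" "Q \<noteq> {}" "\<And>q. q \<in> Q \<Longrightarrow> prime q"
  shows "card Q + 1 \<le> Max Q"
proof -
  have "Q \<subseteq> {2..Max Q}" using assms(1) prime_ge_2_nat[OF assms(3)] by auto
  then have "card Q \<le> card {2..Max Q}" by (intro card_mono) auto
  moreover have "Max Q \<ge> 2" using assms Max_in prime_ge_2_nat by blast
  ultimately show ?thesis by simp
qed

text \<open>Primes above 3 lie in the two residue classes prime to 6, so division by 3 is injective on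
  them.\<close>
lemma three_card_primes_le:
  fixes Q :: "nat set"
  assumes "finite Q" "Q \<noteq> {}" "\<And>q. q \<in> Q \<Longrightarrow> prime q"
  shows "3 * card Q \<le> Max Q + 5"
proof (cases "Max Q \<le> 3")
  case True
  then show ?thesis using card_primes_less_Max[OF assms] by simp
next
  case False
  let ?M = "Max Q"
  have n3: "\<not> 3 dvd q" "\<not> 2 dvd q" if "prime q" "q > 3" for q :: nat
    using that primes_dvd_imp_eq[of 3 q] primes_dvd_imp_eq[of 2 q] by auto
  have "inj_on (\<lambda>q. q div 3) (Q - {2, 3})"
  proof (rule inj_onI)
    fix p q assume *: "p \<in> Q - {2, 3}" "q \<in> Q - {2, 3}" "p div 3 = q div 3"
    have "prime p" "prime q" "p > 3" "q > 3"
      using * assms(3)[of p] assms(3)[of q] prime_ge_2_nat[of p] prime_ge_2_nat[of q] by auto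
    then have "\<not> 3 dvd p" "\<not> 2 dvd p" "\<not> 3 dvd q" "\<not> 2 dvd q" using n3 by auto
    then have odd: "odd p" "odd q" and "p mod 3 = 1 \<or> p mod 3 = 2" "q mod 3 = 1 \<or> q mod 3 = 2"
      by presburger+
    moreover have "p = 3 * (q div 3) + p mod 3" "q = 3 * (q div 3) + q mod 3"
      using *(3) mult_div_mod_eq[of 3 p] mult_div_mod_eq[of 3 q] by simp_all
    moreover have "x = y" if "x = 3 * m + a" "y = 3 * m + b" "a = 1 \<or> a = 2" "b = 1 \<or> b = 2"
      "odd x" "odd y" for x y m a b :: nat
      using that by auto
    ultimately show "p = q" by blast
  qed
  then have "card (Q - {2, 3}) = card ((\<lambda>q. q div 3) ` (Q - {2, 3}))"
    by (simp add: card_image)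
  also have "\<dots> \<le> card {1..?M div 3}"
  proof (intro card_mono subsetI)
    fix y assume "y \<in> (\<lambda>q. q div 3) ` (Q - {2, 3})"
    then obtain q where q: "q \<in> Q" "q \<noteq> 2" "q \<noteq> 3" "y = q div 3" by auto
    then have "q > 3" "q \<le> ?M" using assms prime_ge_2_nat[of q] by force+
    then show "y \<in> {1..?M div 3}" using q by (auto intro: div_le_mono)
  qed simp
  finally have "card (Q - {2, 3}) \<le> ?M div 3" by simp
  moreover have "card Q \<le> card (Q - {2, 3}) + 2"
    using card_Diff_subset_Int[of Q "{2, 3}"] card_mono[of "{2, 3::nat}" "Q \<inter> {2, 3}"] assms(1)
    by simp
  moreover have "?M mod 3 \<noteq> 0"
    using n3(1)[of ?M] False assms Max_in by (auto simp: dvd_eq_mod_eq_0)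
  moreover have "3 * (?M div 3) + ?M mod 3 = ?M" by simp
  ultimately show ?thesis by linarith
qed

lemma remove_Max:
  fixes Q :: "nat set"
  assumes "finite Q" "card Q = Suc i"
  shows "finite (Q - {Max Q})" "card (Q - {Max Q}) = i" "Max Q \<in> Q"
        "Q = insert (Max Q) (Q - {Max Q})" "Max Q \<notin> Q - {Max Q}"
proof -
  have "Q \<noteq> {}" using assms by auto
  then show "Max Q \<in> Q" using assms Max_in by blast
  then show "finite (Q - {Max Q})" "card (Q - {Max Q}) = i"
    "Q = insert (Max Q) (Q - {Max Q})" "Max Q \<notin> Q - {Max Q}" using assms by auto
qed

lemma Suc_power_le:
  assumes "i \<ge> 17"
  shows "(i + 1) ^ (i + 1) \<le> (3 * i - 2) * i ^ i"
proof -
  have i: "real i > 0" using assms by simp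
  have "(1 + 1 / real i) ^ i \<le> exp (1 / real i) ^ i"
    by (intro power_mono) (auto simp: add_nonneg_nonneg)
  also have "\<dots> = exp 1" using i by (simp add: exp_of_nat_mult [symmetric])
  also have "\<dots> \<le> 272 / 100" using e_less_272 by simp
  finally have "(1 + 1 / real i) ^ i * real i ^ i \<le> 272 / 100 * real i ^ i"
    by (intro mult_right_mono) auto
  also have "(1 + 1 / real i) ^ i * real i ^ i = (real i + 1) ^ i"
    using i by (simp add: power_mult_distrib [symmetric] field_simps)
  finally have "(real i + 1) ^ i \<le> 272 / 100 * real i ^ i" .
  then have "(real i + 1) * (real i + 1) ^ i \<le> (real i + 1) * (272 / 100 * real i ^ i)"
    by (intro mult_left_mono) auto
  also have "\<dots> = ((real i + 1) * (272 / 100)) * real i ^ i" by simp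
  also have "\<dots> \<le> (3 * real i - 2) * real i ^ i"
    using assms by (intro mult_right_mono) auto
  finally have "real ((i + 1) ^ (i + 1)) \<le> real ((3 * i - 2) * i ^ i)"
    using assms by (simp only: of_nat_power of_nat_mult of_nat_add of_nat_1 power_add power_one_right
        of_nat_diff mult.commute) simp
  then show ?thesis by (simp only: of_nat_le_iff)
qed

lemma prod_primes_ge:
  assumes "finite Q" "\<And>q. q \<in> Q \<Longrightarrow> prime q"
  shows "(\<Prod>j=1..card Q. max (j + 1) (3 * j - 5)) \<le> \<Prod>Q"
  using assms
proof (induction "card Q" arbitrary: Q)
  case 0
  then show ?case by simp
next
  case (Suc i)
  note Q = remove_Max[OF Suc.prems(1) Suc.hyps(2)[symmetric]]
  have "Q \<noteq> {}" using Q(3) by auto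
  then have "max (card Q + 1) (3 * card Q - 5) \<le> Max Q"
    using card_primes_less_Max[OF Suc.prems(1) _ Suc.prems(2)]
      three_card_primes_le[OF Suc.prems(1) _ Suc.prems(2)] by simp
  moreover have "(\<Prod>j=1..i. max (j + 1) (3 * j - 5)) \<le> \<Prod>(Q - {Max Q})"
    using Suc.hyps(1)[of "Q - {Max Q}"] Suc.prems Q by auto
  moreover have "\<Prod>Q = Max Q * \<Prod>(Q - {Max Q})"
    using Suc.prems Q(3) by (simp add: prod.remove)
  ultimately show ?case
    unfolding Suc.hyps(2)[symmetric] by (simp add: mult.commute mult_mono)
qed

text \<open>Passing from \<open>i\<close> to \<open>i + 1\<close> multiplies the left side by less than \<open>e * (i + 1)\<close> and the
  right side by \<open>3 * i - 2\<close>. From \<open>i = 17\<close> on the latter is larger, so the inequality persists once it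
  holds, as it does for \<open>i = 36\<close>.\<close>
lemma power_self_le_prod_primes:
  assumes "i \<ge> 36"
  shows "i ^ i \<le> (\<Prod>j=1..i. max (j + 1) (3 * j - (5::nat)))"
  using assms
proof (induction i rule: dec_induct)
  case base
  have eq: "{1..36::nat} = set [1..<37]" by auto
  show ?case unfolding eq
    by (subst prod.distinct_set_conv_list) (simp_all add: upt_rec_numeral upt_conv_Cons del: set_upt)
next
  case (step i)
  have "Suc i ^ Suc i \<le> (3 * i - 2) * i ^ i"
    using Suc_power_le[of i] step.hyps by simp
  also have "\<dots> \<le> max (Suc i + 1) (3 * Suc i - 5) * (\<Prod>j=1..i. max (j + 1) (3 * j - 5))"
    using step.IH by (intro mult_mono) auto
  finally show ?case by (simp add: mult.commute)
qed

text \<open>In logarithmic form: the \<open>i\<close>-th prime is at least \<open>i * ln i / ln 4\<close>. Stating it for an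
  arbitrary set of primes avoids enumerating primes. For many primes their product lies between
  \<open>i ^ i\<close> and a primorial; for few primes the bound \<open>3 * i - 5\<close> for the largest is good enough.\<close>
lemma card_power_card_le_4_power_Max:
  assumes "finite Q" "Q \<noteq> {}" "\<And>q. q \<in> Q \<Longrightarrow> prime q"
  shows "card Q ^ card Q \<le> 4 ^ Max Q"
proof (cases "card Q \<le> 36")
  case True
  have eq: "{2..36::nat} = set [2..<37]" unfolding set_upt by auto
  have "\<forall>i\<in>{2..36::nat}. i ^ i \<le> 4 ^ (3 * i - 5)"
    unfolding eq by (simp add: upt_rec_numeral del: set_upt)
  moreover have "card Q \<ge> 1" using assms by (simp add: Suc_le_eq card_gt_0_iff)
  ultimately have "card Q = 1 \<or> card Q ^ card Q \<le> 4 ^ (3 * card Q - 5)" using True by auto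
  moreover have "(4::nat) ^ (3 * card Q - 5) \<le> 4 ^ Max Q"
    using three_card_primes_le[OF assms] by (intro power_increasing) auto
  ultimately show ?thesis by (elim disjE) (simp, rule order_trans)
next
  case False
  then have "card Q ^ card Q \<le> (\<Prod>j=1..card Q. max (j + 1) (3 * j - 5))"
    by (intro power_self_le_prod_primes) simp
  also have "\<dots> \<le> \<Prod>Q" using assms by (intro prod_primes_ge)
  also have "\<dots> \<le> \<Prod>{p. prime p \<and> p \<le> Max Q}"
  proof (rule dvd_imp_le)
    show "\<Prod>Q dvd \<Prod>{p. prime p \<and> p \<le> Max Q}"
    proof (rule prod_dvd_prod_subset)
      show "finite {p::nat. prime p \<and> p \<le> Max Q}"
        by (rule finite_subset[of _ "{..Max Q}"]) auto
    qed (use assms in auto)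
    show "0 < \<Prod>{p::nat. prime p \<and> p \<le> Max Q}"
      by (intro prod_pos) (auto dest: prime_gt_0_nat)
  qed
  also have "\<dots> \<le> 4 ^ Max Q" by (rule primorial_le)
  finally show ?thesis .
qed

section \<open>Sums of reciprocals of primes\<close>

lemma Max_primes_ge:
  fixes Q :: "nat set"
  assumes "finite Q" "\<And>q. q \<in> Q \<Longrightarrow> prime q" "card Q \<ge> 2"
  shows "1 / real (Max Q) \<le> ln 4 / (real (card Q) * ln (real (card Q)))"
proof -
  let ?i = "real (card Q)" and ?M = "real (Max Q)"
  have ne: "Q \<noteq> {}" using assms(3) by auto
  have "real (card Q ^ card Q) \<le> real (4 ^ Max Q)"
    using card_power_card_le_4_power_Max[OF assms(1) ne assms(2)] by (simp only: of_nat_le_iff)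
  then have "ln (?i ^ card Q) \<le> ln (4 ^ Max Q)"
    using assms(3) by (subst ln_le_cancel_iff) auto
  then have *: "?i * ln ?i \<le> ?M * ln 4"
    using assms(3) by (simp add: ln_realpow)
  have "?M > 0" using card_primes_less_Max[OF assms(1) ne assms(2)] by simp
  moreover have "?i * ln ?i > 0" using assms(3) by simp
  ultimately show ?thesis using * by (simp add: field_simps)
qed

text \<open>An upper bound for the reciprocal of the \<open>i\<close>-th prime, \<open>i\<close> counted from 1. The logarithmic
  bound is poor for the first three primes and meaningless for \<open>i = 1\<close>.\<close>
definition reciprocal_bound :: "nat \<Rightarrow> real" where
  "reciprocal_bound i = (if i \<le> 3 then 1 / real (i + 1) else ln 4 / (real i * ln (real i)))"

text \<open>Removing the largest prime repeatedly leaves the \<open>s\<close> smallest ones.\<close>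
lemma large_primes_split:
  fixes Q :: "nat set"
  assumes "finite Q" "\<And>q. q \<in> Q \<Longrightarrow> prime q" "s \<le> card Q"
  shows "\<exists>A\<subseteq>Q. card A = s \<and> (\<Sum>q\<in>Q - A. 1 / real q) \<le> (\<Sum>i\<in>{s<..card Q}. reciprocal_bound i)"
  using assms
proof (induction "card Q - s" arbitrary: Q)
  case 0
  then show ?case by (intro exI[of _ Q]) auto
next
  case (Suc d)
  obtain i where i: "card Q = Suc i" using Suc.hyps by (cases "card Q") auto
  note M = remove_Max[OF Suc.prems(1) i]
  let ?M = "Max Q"
  have "s \<le> i" "d = i - s" using Suc.hyps i by auto
  then obtain A where A: "A \<subseteq> Q - {?M}" "card A = s"
    "(\<Sum>q\<in>Q - {?M} - A. 1 / real q) \<le> (\<Sum>j\<in>{s<..i}. reciprocal_bound j)"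
    using Suc.hyps(1)[of "Q - {?M}"] M Suc.prems by auto
  have "Q - A = insert ?M (Q - {?M} - A)" using A M by auto
  then have "(\<Sum>q\<in>Q - A. 1 / real q) = 1 / real ?M + (\<Sum>q\<in>Q - {?M} - A. 1 / real q)"
    using Suc.prems(1) by simp
  also have "1 / real ?M \<le> reciprocal_bound (Suc i)"
  proof (cases "Suc i \<le> 3")
    case True
    have "Suc i + 1 \<le> ?M" using card_primes_less_Max[of Q] Suc.prems M(3) i by auto
    then have "real (Suc i + 1) \<le> real ?M" by (simp only: of_nat_le_iff)
    then show ?thesis using True by (simp add: reciprocal_bound_def frac_le)
  next
    case False
    then show ?thesis using Max_primes_ge[of Q] Suc.prems i by (simp add: reciprocal_bound_def)
  qed
  also have "{s<..card Q} = insert (Suc i) {s<..i}" using i \<open>s \<le> i\<close> by auto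
  then have "reciprocal_bound (Suc i) + (\<Sum>j\<in>{s<..i}. reciprocal_bound j) = (\<Sum>j\<in>{s<..card Q}. reciprocal_bound j)"
    by simp
  ultimately show ?case
    using A by (intro exI[of _ A]) auto
qed

text \<open>The terms \<open>1 / (i * ln i)\<close> are dominated by the differences of \<open>ln (ln i)\<close>; both estimates
  behind this are instances of \<open>ln x \<le> x - 1\<close>.\<close>
lemma sum_reciprocal_bound:
  assumes "3 \<le> s" "s \<le> k"
  shows "(\<Sum>i\<in>{s<..k}. reciprocal_bound i) \<le> ln 4 * (ln (ln (real k)) - ln (ln (real s)))"
  using assms(2)
proof (induction k rule: dec_induct)
  case (step i)
  have i: "i \<ge> 3" using assms step.hyps by simp
  let ?x = "ln (real i)" and ?y = "ln (real (Suc i))"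
  have pos: "?x > 0" "?y > 0" using i by auto
  have "ln (real i / real (Suc i)) \<le> real i / real (Suc i) - 1"
    using i by (intro ln_le_minus_one) auto
  then have "1 / real (Suc i) \<le> ?y - ?x" using i by (simp add: ln_div field_simps)
  then have "1 / real (Suc i) / ?y \<le> (?y - ?x) / ?y" using pos by (intro divide_right_mono) auto
  also have "\<dots> = 1 - ?x / ?y" using pos by (simp add: diff_divide_distrib)
  also have "\<dots> \<le> ln ?y - ln ?x"
    using ln_le_minus_one[of "?x / ?y"] pos by (simp add: ln_div)
  finally have "ln 4 * (1 / real (Suc i) / ?y) \<le> ln 4 * (ln ?y - ln ?x)"
    by (intro mult_left_mono) auto
  moreover have "reciprocal_bound (Suc i) = ln 4 * (1 / real (Suc i) / ?y)"
    using i by (simp add: reciprocal_bound_def)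
  moreover have "{s<..Suc i} = insert (Suc i) {s<..i}" using step.hyps by auto
  ultimately show ?case using step.IH by (simp add: algebra_simps)
qed simp

lemma sum_reciprocals_le:
  fixes Q :: "nat set"
  assumes "finite Q" "\<And>q. q \<in> Q \<Longrightarrow> prime q" "card Q = s" "s \<ge> 3"
  shows "(\<Sum>q\<in>Q. 1 / real q) \<le> 13 / 12 + ln 4 * (ln (ln (real s)) - ln (ln 3))"
proof -
  obtain A where A: "A \<subseteq> Q" "card A = 0" "(\<Sum>q\<in>Q - A. 1 / real q) \<le> (\<Sum>i\<in>{0<..s}. reciprocal_bound i)"
    using large_primes_split[of Q 0] assms by auto
  have "A = {}" using A assms(1) finite_subset by fastforce
  moreover have U: "{0<..s} = {1,2,3} \<union> {3<..s}" using assms(4) by auto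
  have "(\<Sum>i\<in>{0<..s}. reciprocal_bound i) = 13 / 12 + (\<Sum>i\<in>{3<..s}. reciprocal_bound i)"
    unfolding U by (subst sum.union_disjoint) (auto simp: reciprocal_bound_def)
  ultimately show ?thesis using A(3) sum_reciprocal_bound[of 3 s] assms(4) by simp
qed

text \<open>The product telescopes when the \<open>i\<close>-th prime is replaced by \<open>i + 1\<close>.\<close>
lemma prod_ge_inverse_card:
  fixes Q :: "nat set"
  assumes "finite Q" "\<And>q. q \<in> Q \<Longrightarrow> prime q"
  shows "1 / (real (card Q) + 1) \<le> (\<Prod>q\<in>Q. 1 - 1 / real q)"
  using assms
proof (induction "card Q" arbitrary: Q)
  case 0
  then show ?case by simp
next
  case (Suc i)
  note M = remove_Max[OF Suc.prems(1) Suc.hyps(2)[symmetric]]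
  have "Q \<noteq> {}" using M(3) by auto
  have "Suc i + 1 \<le> Max Q"
    using card_primes_less_Max[OF Suc.prems(1) \<open>Q \<noteq> {}\<close> Suc.prems(2)] Suc.hyps by simp
  then have "real i + 2 \<le> real (Max Q)" by linarith
  then have "1 - 1 / (real i + 2) \<le> 1 - 1 / real (Max Q)" by (simp add: frac_le)
  moreover have "1 / (real i + 1) \<le> (\<Prod>q\<in>Q - {Max Q}. 1 - 1 / real q)"
    using Suc.hyps(1)[of "Q - {Max Q}"] M Suc.prems by auto
  ultimately have "(1 - 1 / (real i + 2)) * (1 / (real i + 1)) \<le>
      (1 - 1 / real (Max Q)) * (\<Prod>q\<in>Q - {Max Q}. 1 - 1 / real q)"
    using \<open>real i + 2 \<le> real (Max Q)\<close> by (intro mult_mono) (auto simp: field_simps)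
  also have "\<dots> = (\<Prod>q\<in>Q. 1 - 1 / real q)"
    using Suc.prems M(3) by (simp add: prod.remove)
  also have "(1 - 1 / (real i + 2)) * (1 / (real i + 1)) = 1 / (real (card Q) + 1)"
    using Suc.hyps by (simp add: field_simps)
  finally show ?case .
qed

section \<open>Two bounds for the Jacobsthal function\<close>

text \<open>With truncation at or beyond the size of \<open>A\<close> the inclusion-exclusion over \<open>A\<close> is exact, and its
  error is the number of all subsets.\<close>
lemma jacobsthal_le_full:
  assumes "n > 0" "A \<subseteq> prime_factors n" "card A = s" "0 < \<delta>"
    and c: "(\<Sum>q\<in>prime_factors n - A. 1 / real q) \<le> 1 - \<delta>"
  shows "real (jacobsthal n) \<le>
    1 + (real s + 1) * 2 ^ s * (real (card (prime_factors n - A)) + 1) / \<delta>"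
proof -
  let ?B = "prime_factors n - A" and ?m = "jacobsthal n - 1"
  let ?P = "\<Prod>q\<in>A. 1 - 1 / real q" and ?c = "\<Sum>q\<in>?B. 1 / real q"
  have fin: "finite A" "finite ?B" using assms(2) finite_subset by auto
  have primes: "prime q" if "q \<in> A \<union> ?B" for q using that assms(2) by auto
  obtain a where a: "\<And>x. x \<in> interval a ?m \<Longrightarrow> \<exists>q\<in>prime_factors n. int q dvd x"
    using jacobsthal_gap[OF assms(1)] by blast
  have "real ?m * (?P * (1 - ?c) - 2 * tail_term (2 * s) A)
      \<le> real (card (small_subsets (Suc (2 * s)) A)) + real (card ?B) * real (card (small_subsets (2 * s) A))"
    using a assms(2,4) c primes fin by (intro sieve_inequality[where a = a]) auto
  then have *: "real ?m * (?P * (1 - ?c)) \<le> 2 ^ s * (real (card ?B) + 1)"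
    using fin assms(3) by (simp add: tail_term_eq_0 small_subsets_all card_Pow algebra_simps)
  have "1 / (real s + 1) * \<delta> \<le> ?P * (1 - ?c)"
    using prod_ge_inverse_card[OF fin(1)] primes assms c
    by (intro mult_mono) (auto intro: order_trans[rotated])
  then have "real ?m * (1 / (real s + 1) * \<delta>) \<le> real ?m * (?P * (1 - ?c))"
    by (intro mult_left_mono) auto
  with * have "real ?m * (1 / (real s + 1) * \<delta>) \<le> 2 ^ s * (real (card ?B) + 1)" by linarith
  then have "real ?m \<le> (real s + 1) * 2 ^ s * (real (card ?B) + 1) / \<delta>"
    using assms(4) by (simp add: field_simps)
  then show ?thesis by linarith
qed

text \<open>The condition on \<open>v\<close> makes the truncation error a small part of the main term, which is at
  least \<open>4 powr (- \<sigma>) / 32\<close>; at least half of it survives. The number of terms is then polynomial in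
  \<open>s\<close> of degree \<open>v\<close>, instead of exponential in \<open>s\<close>.\<close>
lemma jacobsthal_le_truncated:
  assumes "n > 0" "A \<subseteq> prime_factors n" "card A = s"
    and c: "(\<Sum>q\<in>prime_factors n - A. 1 / real q) \<le> 31 / 32"
    and S: "(\<Sum>q\<in>A. 1 / real q) \<le> \<sigma>"
    and v: "even v" "4 * \<sigma> + 5 / 2 \<le> real v"
  shows "real (jacobsthal n) \<le>
    1 + 64 * 4 powr \<sigma> * (real (card (prime_factors n)) + 1) * (real s + 1) ^ v"
proof -
  let ?B = "prime_factors n - A" and ?m = "jacobsthal n - 1"
  let ?P = "\<Prod>q\<in>A. 1 - 1 / real q" and ?c = "\<Sum>q\<in>?B. 1 / real q"
  let ?S = "\<Sum>q\<in>A. 1 / real q"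
  have fin: "finite A" "finite ?B" using assms(2) finite_subset by auto
  have primes: "prime q" if "q \<in> A \<union> ?B" for q using that assms(2) by auto
  have ge2: "q \<ge> 2" if "q \<in> A" for q using primes[of q] that prime_ge_2_nat by blast
  obtain a where a: "\<And>x. x \<in> interval a ?m \<Longrightarrow> \<exists>q\<in>prime_factors n. int q dvd x"
    using jacobsthal_gap[OF assms(1)] by blast
  have "real ?m * (?P * (1 - ?c) - 2 * tail_term v A)
      \<le> real (card (small_subsets (Suc v) A)) + real (card ?B) * real (card (small_subsets v A))"
    using a assms(2) c v primes fin by (intro sieve_inequality[where a = a]) auto
  also have "\<dots> \<le> (real s + 1) ^ Suc v + real (card ?B) * (real s + 1) ^ v"
  proof -
    have E: "real (card (small_subsets w A)) \<le> (real s + 1) ^ w" for w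
    proof -
      have "real (card (small_subsets w A)) \<le> real ((card A + 1) ^ w)"
        using card_small_subsets_le[OF fin(1), of w] by (simp only: of_nat_le_iff)
      then show ?thesis using assms(3) by (simp add: add.commute)
    qed
    show ?thesis by (intro add_mono mult_left_mono E) auto
  qed
  also have "\<dots> = (real (card (prime_factors n)) + 1) * (real s + 1) ^ v"
  proof -
    have "card (prime_factors n) = card A + card ?B"
      using fin assms(2) by (metis card_Diff_subset card_mono finite_set_mset le_add_diff_inverse)
    then show ?thesis using assms(3) by (simp add: algebra_simps)
  qed
  finally have *: "real ?m * (?P * (1 - ?c) - 2 * tail_term v A)
      \<le> (real (card (prime_factors n)) + 1) * (real s + 1) ^ v" .
  have P: "4 powr (- \<sigma>) \<le> ?P"
    by (rule order_trans[OF _ prod_ge_4_powr[OF fin(1) ge2]]) (use S in auto)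
  have main: "4 powr (- \<sigma>) * (1 / 32) \<le> ?P * (1 - ?c)"
    using P c by (intro mult_mono) (auto intro: order_trans[rotated])
  have ln4: "4 / 3 \<le> ln (4::real)" and ln4': "ln 4 = 2 * ln (2::real)"
    using ln_realpow[of "2::real" 2] ln2_ge_two_thirds by simp_all
  \<comment> \<open>a quarter of the lower bound for the main term; the sieve inequality subtracts the tail twice\<close>
  have tail: "tail_term v A \<le> 4 powr (- \<sigma>) * (1 / 128)"
  proof -
    have "tail_term v A \<le> exp (4 * ?S) / 4 ^ (v + 1)"
      using fin(1) ge2 by (intro tail_term_le) (auto intro: less_le_trans[of 0 2])
    also have "\<dots> \<le> exp (4 * \<sigma>) / 4 ^ (v + 1)"
      using S by (intro divide_right_mono) auto
    also have "\<dots> = exp (4 * \<sigma> - ln 4 * (real v + 1))"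
    proof -
      have "(4::real) ^ (v + 1) = 4 powr (real v + 1)"
        using powr_realpow[of "4::real" "v + 1"] by (simp add: add.commute)
      then show ?thesis by (simp add: powr_def exp_diff mult.commute)
    qed
    also have "\<dots> \<le> exp (- \<sigma> * ln 4 - 7 * ln 2)"
    proof -
      have S0: "0 \<le> \<sigma>" by (rule order_trans[OF _ S]) (simp add: sum_nonneg)
      have "ln 4 * (4 * \<sigma> + 7 / 2) \<le> ln 4 * (real v + 1)"
        using v(2) by (intro mult_left_mono) auto
      moreover have "4 / 3 * (3 * \<sigma>) \<le> ln 4 * (3 * \<sigma>)"
        using ln4 S0 by (intro mult_right_mono) auto
      ultimately show ?thesis by (simp add: ln4' algebra_simps)
    qed
    also have "\<dots> = 4 powr (- \<sigma>) * (1 / 128)"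
    proof -
      have "7 * ln 2 = ln (128::real)" using ln_realpow[of "2::real" 7] by simp
      then show ?thesis by (simp add: powr_def exp_diff)
    qed
    finally show ?thesis .
  qed
  have "real ?m * (4 powr (- \<sigma>) * (1 / 64)) \<le> real ?m * (?P * (1 - ?c) - 2 * tail_term v A)"
    using main tail by (intro mult_left_mono) auto
  with * have "real ?m * (4 powr (- \<sigma>) * (1 / 64))
      \<le> (real (card (prime_factors n)) + 1) * (real s + 1) ^ v" by linarith
  then have "real ?m \<le> 64 * 4 powr \<sigma> * ((real (card (prime_factors n)) + 1) * (real s + 1) ^ v)"
    by (simp add: powr_minus field_simps)
  then show ?thesis by (simp add: mult.assoc)
qed

text \<open>This is why the square root of the number of primes is the right place to split: there the
  large primes have reciprocal sum at most \<open>ln 4 * ln 2\<close>, which is 0.96... and hence below 1.\<close>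
lemma sum_reciprocal_bound_le_31_32:
  assumes "3 \<le> s" "s \<le> k" "k \<le> s\<^sup>2"
  shows "(\<Sum>i\<in>{s<..k}. reciprocal_bound i) \<le> 31 / 32"
proof -
  have "ln (real k) \<le> ln (real s ^ 2)"
    using assms by (subst ln_le_cancel_iff) (auto simp flip: of_nat_power)
  then have "ln (real k) \<le> 2 * ln (real s)" using assms by (simp add: ln_realpow)
  then have "ln (ln (real k)) \<le> ln (2 * ln (real s))"
    using assms by (subst ln_le_cancel_iff) auto
  also have "\<dots> = ln 2 + ln (ln (real s))" using assms by (subst ln_mult) auto
  finally have "ln 4 * (ln (ln (real k)) - ln (ln (real s))) \<le> ln 4 * ln 2"
    by (intro mult_left_mono) auto
  also have "\<dots> = 2 * (ln 2 * ln 2)" using ln_realpow[of "2::real" 2] by simp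
  also have "ln 2 * ln 2 \<le> (25 / 36) * (25 / 36 :: real)"
    using ln2_le_25_over_36 by (intro mult_mono) auto
  finally show ?thesis using sum_reciprocal_bound[OF assms(1,2)] by simp
qed

section \<open>Comparison with the stated bound\<close>

abbreviation target :: "real \<Rightarrow> real" where
  "target k \<equiv> k powr (3 + 3.81 * ln (ln k))"

lemma target_ge:
  fixes a k y e :: real
  assumes "1 < a" "a \<le> k" "0 < y" "y \<le> ln a" "0 \<le> e" "e \<le> 3 + 3.81 * ln y"
  shows "a powr e \<le> target k"
proof -
  have "ln a \<le> ln k" using assms by (subst ln_le_cancel_iff) auto
  then have "y \<le> ln k" using assms by linarith
  then have "ln y \<le> ln (ln k)" using assms by (subst ln_le_cancel_iff) auto
  then have "3 + 3.81 * ln y \<le> 3 + 3.81 * ln (ln k)"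
    by (intro add_left_mono mult_left_mono) simp_all
  with assms(6) have "e \<le> 3 + 3.81 * ln (ln k)" by (rule order_trans)
  have "a powr e \<le> k powr e" using assms by (intro powr_mono2) auto
  also have "\<dots> \<le> k powr (3 + 3.81 * ln (ln k))"
    using \<open>e \<le> 3 + 3.81 * ln (ln k)\<close> assms by (intro powr_mono) auto
  finally show ?thesis .
qed

lemma less_powr_fraction:
  fixes b c :: real
  assumes "0 < b" "0 < c" "0 < q" "b ^ q < c ^ p"
  shows "b < c powr (real p / real q)"
proof -
  have "real q * ln b < real p * ln c"
    using assms ln_less_cancel_iff[of "b ^ q" "c ^ p"] by (simp add: ln_realpow)
  then have "ln b < real p / real q * ln c" using assms by (simp add: field_simps)
  then have "exp (ln b) < exp (real p / real q * ln c)" by (simp only: exp_less_cancel_iff)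
  then show ?thesis using assms by (simp add: powr_def)
qed

lemma ln_ge_frac:
  fixes x :: real
  assumes "x > 0"
  shows "1 - 1 / x \<le> ln x"
  using ln_le_minus_one[of "1 / x"] assms by (simp add: ln_div)

lemma ln_2_power_mult:
  fixes y :: real
  assumes "y > 0"
  shows "ln (2 ^ j * y) = real j * ln 2 + ln y"
  using assms by (simp add: ln_mult_pos ln_realpow)

lemma ln_3_ge: "109 / 100 \<le> ln (3::real)"
proof -
  have "exp 109 = exp (1::real) ^ 109" using exp_of_nat_mult[of 109 "1::real"] by simp
  also have "\<dots> \<le> (272 / 100) ^ 109" using e_less_272 by (intro power_mono) auto
  also have "\<dots> \<le> 3 ^ 100" by (simp add: power_divide)
  finally have "ln (exp 109) \<le> ln ((3::real) ^ 100)" by (subst ln_le_cancel_iff) auto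
  then have "109 \<le> real 100 * ln (3::real)" unfolding ln_exp ln_realpow .
  then show ?thesis by simp
qed

lemma jacobsthal_le_no_large:
  assumes "n > 0" "card (prime_factors n) = k"
  shows "real (jacobsthal n) \<le> 1 + (real k + 1) * 2 ^ k"
  using jacobsthal_le_full[of n "prime_factors n" k 1] assms by simp

lemma jacobsthal_le_split:
  assumes "n > 0" "card (prime_factors n) = k" "3 \<le> s" "s \<le> k" "k \<le> s\<^sup>2"
  shows "real (jacobsthal n) \<le> 1 + 32 * (real s + 1) * 2 ^ s * (real k - real s + 1)"
proof -
  obtain A where A: "A \<subseteq> prime_factors n" "card A = s"
    "(\<Sum>q\<in>prime_factors n - A. 1 / real q) \<le> (\<Sum>i\<in>{s<..k}. reciprocal_bound i)"
    using large_primes_split[of "prime_factors n" s] assms by auto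
  have "finite A" using A(1) finite_subset by auto
  then have B: "real (card (prime_factors n - A)) = real k - real s"
    using A(1,2) assms by (simp add: card_Diff_subset of_nat_diff)
  have "(\<Sum>q\<in>prime_factors n - A. 1 / real q) \<le> 1 - 1 / 32"
    using A(3) sum_reciprocal_bound_le_31_32[OF assms(3,4,5)] assms(2) by simp
  from jacobsthal_le_full[OF assms(1) A(1,2) _ this] show ?thesis
    unfolding B by (simp add: algebra_simps)
qed

text \<open>On each range of \<open>k\<close> the upper bound is evaluated at the right end, the target at or just below
  the left end, and rational exponents reduce the comparison to powers of integers. In the
  first three ranges all primes go into \<open>A\<close>; in the others \<open>s = 4, 10, 32\<close> is
  the least integer with square at least the right end.\<close>
lemma jacobsthal_small:
  assumes "n > 0" "card (prime_factors n) = k" "2 < k" "k < 1024"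
  shows "real (jacobsthal n) < target (real k)"
proof -
  note l2 = ln2_ge_two_thirds
  have full: "real (jacobsthal n) < target (real k)"
    if "k \<le> b" "1 + (real b + 1) * 2 ^ b \<le> N" "N < a powr e" "a powr e \<le> target (real k)" for b N a e
  proof -
    have "1 + (real k + 1) * 2 ^ k \<le> 1 + (real b + 1) * 2 ^ b"
      using that(1) by (intro add_mono mult_mono power_increasing) auto
    then show ?thesis using jacobsthal_le_no_large[OF assms(1,2)] that by linarith
  qed
  have split: "real (jacobsthal n) < target (real k)"
    if "3 \<le> s" "s \<le> k" "k \<le> b" "b \<le> s\<^sup>2" "1 + 32 * (real s + 1) * 2 ^ s * (real b - real s + 1) \<le> N"
      "N < a powr e" "a powr e \<le> target (real k)" for s b N a e
  proof -
    have "1 + 32 * (real s + 1) * 2 ^ s * (real k - real s + 1)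
        \<le> 1 + 32 * (real s + 1) * 2 ^ s * (real b - real s + 1)"
      using that by (intro add_left_mono mult_left_mono) auto
    then show ?thesis using jacobsthal_le_split[OF assms(1,2), of s] that by linarith
  qed
  consider "k = 3" | "4 \<le> k" "k \<le> 5" | "6 \<le> k" "k \<le> 7" | "8 \<le> k" "k \<le> 16"
    | "17 \<le> k" "k \<le> 100" | "101 \<le> k" "k \<le> 1023" using assms by linarith
  then show ?thesis
  proof cases
    case 1
    have "33 < 3 powr (real 33 / real 10)" by (rule less_powr_fraction) auto
    moreover have "3 powr (real 33 / real 10) \<le> target (real k)"
      using ln_3_ge ln_ge_frac[of "109/100"] 1 by (intro target_ge[where y = "109/100"]) auto
    ultimately show ?thesis using 1 by (intro full[of 3 33]) auto
  next
    case 2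
    have "193 < 4 powr (real 39 / real 10)" by (rule less_powr_fraction) auto
    moreover have "4 powr (real 39 / real 10) \<le> target (real k)"
    proof (rule target_ge[where y = "4/3"])
      show "4 / 3 \<le> ln (4::real)" using l2 ln_realpow[of "2::real" 2] by simp
    qed (use 2 ln_ge_frac[of "4/3"] in auto)
    ultimately show ?thesis using 2 by (intro full[of 5 193]) auto
  next
    case 3
    have "1025 < 6 powr (real 9 / real 2)" by (rule less_powr_fraction) auto
    moreover have "6 powr (real 9 / real 2) \<le> target (real k)"
    proof (rule target_ge[where y = "5/3"])
      have "ln ((2::real) ^ 5) \<le> ln (6 ^ 2)" by (subst ln_le_cancel_iff) auto
      then show "5 / 3 \<le> ln (6::real)" using l2 by (subst (asm) (1 2) ln_realpow) auto
    qed (use 3 ln_ge_frac[of "5/3"] in auto)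
    ultimately show ?thesis using 3 by (intro full[of 7 1025]) auto
  next
    case 4
    have "33281 < 8 powr (real 11 / real 2)" by (rule less_powr_fraction) auto
    moreover have "8 powr (real 11 / real 2) \<le> target (real k)"
    proof (rule target_ge[where y = 2])
      show "2 \<le> ln (8::real)" using l2 ln_realpow[of "2::real" 3] by simp
    qed (use 4 l2 in auto)
    ultimately show ?thesis using 4 by (intro split[of 4 16 33281]) auto
  next
    case 5
    have "32800769 < 16 powr (real 32 / real 5)" by (rule less_powr_fraction) auto
    moreover have "16 powr (real 32 / real 5) \<le> target (real k)"
    proof (rule target_ge[where y = "2 * (4/3)"])
      show "2 * (4/3) \<le> ln (16::real)" using l2 ln_realpow[of "2::real" 4] by simp
      show "real 32 / real 5 \<le> 3 + 3.81 * ln (2 * (4/3))"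
        using l2 ln_ge_frac[of "4/3"] ln_2_power_mult[of "4/3" 1] by simp
    qed (use 5 in auto)
    ultimately show ?thesis using 5 by (intro split[of 10 100 32800769]) auto
  next
    case 6
    have "1 + 32 * 33 * 2 ^ 32 * 992 < 101 powr (real 33 / real 4)"
      by (rule less_powr_fraction) auto
    moreover have "101 powr (real 33 / real 4) \<le> target (real k)"
    proof (rule target_ge[where y = "2 ^ 2 * (13/12)"])
      have "ln ((2::real) ^ 13) \<le> ln (101 ^ 2)" by (subst ln_le_cancel_iff) auto
      then show "2 ^ 2 * (13/12) \<le> ln (101::real)" using l2 by (subst (asm) (1 2) ln_realpow) auto
      show "real 33 / real 4 \<le> 3 + 3.81 * ln (2 ^ 2 * (13/12))"
        using l2 ln_ge_frac[of "13/12"] ln_2_power_mult[of "13/12" 2] by simp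
    qed (use 6 in auto)
    ultimately show ?thesis using 6 by (intro split[of 32 1023 "1 + 32 * 33 * 2 ^ 32 * 992"]) auto
  qed
qed

text \<open>Here \<open>s\<close> is about the square root of \<open>k\<close>, so the \<open>s ^ v\<close> terms contribute about \<open>v / 2\<close> to the
  exponent of \<open>k\<close>. With \<open>L = ln (ln k)\<close> the reciprocal sum of \<open>A\<close> is at most about \<open>1.39 * L\<close>, and \<open>v\<close>
  at most about four times this plus 4.5; the exponent then grows like \<open>2.83 * L\<close>, up to a
  constant and to factors of the bound that are powers of \<open>ln k\<close>. This is below \<open>3.81 * L\<close>, and
  \<open>L \<ge> 9 / 5\<close> leaves enough room for the constants.\<close>
lemma jacobsthal_large:
  assumes "n > 0" "card (prime_factors n) = k" "1024 \<le> k"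
  shows "real (jacobsthal n) < target (real k)"
proof -
  define l where "l = ln (real k)"
  define L where "L = ln l"
  define s where "s = nat \<lceil>sqrt (real k)\<rceil>"
  note l2 = ln2_ge_two_thirds
  have ln_k: "20 / 3 \<le> l"
  proof -
    have "ln ((2::real) ^ 10) \<le> l" unfolding l_def using assms(3) by (subst ln_le_cancel_iff) auto
    then show ?thesis using l2 by (subst (asm) ln_realpow) auto
  qed
  have L: "9 / 5 \<le> L"
  proof -
    have "ln (2 ^ 3 * (5 / 6)) \<le> L" unfolding L_def using ln_k by (subst ln_le_cancel_iff) auto
    then show ?thesis using l2 ln_ge_frac[of "5/6"] ln_2_power_mult[of "5/6" 3] by simp
  qed
  have sqrt_k: "32 \<le> sqrt (real k)"
    using assms(3) real_le_rsqrt[of 32 "real k"] by simp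
  have s1: "sqrt (real k) \<le> real s" "real s \<le> sqrt (real k) + 1"
    unfolding s_def using sqrt_k by linarith+
  have "real k \<le> real s ^ 2"
    using s1(1) sqrt_k power_mono[of "sqrt (real k)" "real s" 2] by simp
  then have ks: "k \<le> s\<^sup>2" by (simp only: of_nat_le_iff flip: of_nat_power)
  have s3: "3 \<le> s" using s1(1) sqrt_k by linarith
  have sk: "s \<le> k"
  proof -
    have "32 * sqrt (real k) \<le> sqrt (real k) * sqrt (real k)"
      using sqrt_k assms(3) by (intro mult_right_mono) auto
    then have "real s \<le> real k" using s1(2) sqrt_k by simp
    then show ?thesis by simp
  qed
  \<comment> \<open>0.51 instead of 1/2 absorbs the rounding of the square root and the added 1.\<close>
  have ln_s1: "ln (real s + 1) \<le> 51 / 100 * l"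
  proof -
    let ?r = "sqrt (real k)"
    have pos: "?r > 0" using sqrt_k assms(3) by linarith
    have "?r * (1 + 2 / ?r) = ?r + 2" using assms(3) by (simp add: distrib_left)
    then have "ln (real s + 1) \<le> ln (?r * (1 + 2 / ?r))"
      using s1 pos by (subst ln_le_cancel_iff) linarith+
    also have "\<dots> = ln ?r + ln (1 + 2 / ?r)"
      using sqrt_k assms(3) by (intro ln_mult_pos) (auto intro: add_pos_nonneg)
    also have "ln ?r = l / 2" unfolding l_def using assms(3) by (simp add: ln_sqrt)
    also have "ln (1 + 2 / ?r) \<le> 2 / ?r" using sqrt_k assms(3) by (intro ln_add_one_self_le_self) auto
    also have "2 / ?r \<le> 1 / 16" using sqrt_k assms(3) by (simp add: field_simps)
    finally show ?thesis using ln_k by simp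
  qed
  obtain A where A: "A \<subseteq> prime_factors n" "card A = s"
    "(\<Sum>q\<in>prime_factors n - A. 1 / real q) \<le> (\<Sum>i\<in>{s<..k}. reciprocal_bound i)"
    using large_primes_split[of "prime_factors n" s] assms sk by auto
  have c: "(\<Sum>q\<in>prime_factors n - A. 1 / real q) \<le> 31 / 32"
    using A(3) sum_reciprocal_bound_le_31_32[OF s3 sk ks] by simp
  \<comment> \<open>The constant 729/1000 bounds the sum of \<open>- ln 0.51\<close> and \<open>ln (ln 3)\<close> from below.\<close>
  define \<sigma> where "\<sigma> = 13 / 12 + 25 / 18 * (L - 729 / 1000)"
  have \<sigma>: "0 \<le> \<sigma>" using L by (simp add: \<sigma>_def)
  have S: "(\<Sum>q\<in>A. 1 / real q) \<le> \<sigma>"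
  proof -
    have "finite A" "\<And>q. q \<in> A \<Longrightarrow> prime q" using A(1) finite_subset by auto
    then have "(\<Sum>q\<in>A. 1 / real q) \<le> 13 / 12 + ln 4 * (ln (ln (real s)) - ln (ln 3))"
      using sum_reciprocals_le[of A s] A(2) s3 by auto
    moreover have "ln (ln (real s)) - ln (ln 3) \<le> L - 729 / 1000"
    proof -
      have "ln (real s) \<le> ln (real s + 1)" using s3 by (subst ln_le_cancel_iff) auto
      with ln_s1 have "ln (real s) \<le> 51 / 100 * l" by linarith
      then have "ln (ln (real s)) \<le> ln (51 / 100 * l)"
        using s3 ln_k by (subst ln_le_cancel_iff) auto
      also have "\<dots> = ln (51 / 100) + L"
        unfolding L_def using ln_k by (intro ln_mult_pos) auto
      finally have "ln (ln (real s)) \<le> ln (51 / 100) + L" .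
      moreover have "ln (51 / 50) = ln (51 / 100) + ln (2::real)"
        using ln_mult_pos[of "51/100" "2::real"] by simp
      moreover have "ln (51 / 50 :: real) \<le> 1 / 50" using ln_le_minus_one[of "51/50::real"] by simp
      moreover have "ln (109 / 100) \<le> ln (ln (3::real))"
        using ln_3_ge by (subst ln_le_cancel_iff) auto
      moreover have "9 / 109 \<le> ln (109 / 100 :: real)" using ln_ge_frac[of "109/100"] by simp
      ultimately show ?thesis using l2 by linarith
    qed
    moreover have "ln 4 * (L - 729 / 1000) \<le> 25 / 18 * (L - 729 / 1000)"
      using ln2_le_25_over_36 ln_realpow[of "2::real" 2] L by (intro mult_right_mono) auto
    moreover have "ln 4 * (ln (ln (real s)) - ln (ln 3)) \<le> ln 4 * (L - 729 / 1000)"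
      using calculation(2) by (intro mult_left_mono) auto
    ultimately show ?thesis unfolding \<sigma>_def by linarith
  qed
  \<comment> \<open>the least even number permitted by the condition on the truncation\<close>
  define v where "v = 2 * nat \<lceil>2 * \<sigma> + 5 / 4\<rceil>"
  have v: "even v" "4 * \<sigma> + 5 / 2 \<le> real v" "real v \<le> 4 * \<sigma> + 9 / 2"
  proof -
    have "real v = 2 * of_int \<lceil>2 * \<sigma> + 5 / 4\<rceil>" unfolding v_def using \<sigma> by simp
    then show "4 * \<sigma> + 5 / 2 \<le> real v" "real v \<le> 4 * \<sigma> + 9 / 2" by linarith+
  qed (simp add: v_def)
  define X where "X = 4 powr \<sigma> * (real s + 1) ^ v"
  have "1 \<le> 4 powr \<sigma>" using \<sigma> by (intro ge_one_powr_ge_zero) auto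
  then have X1: "1 * 1 \<le> X"
    unfolding X_def by (intro mult_mono one_le_power) auto
  have "real (jacobsthal n) \<le> 1 + 64 * (real k + 1) * X"
    using jacobsthal_le_truncated[OF assms(1) A(1,2) c S v(1,2)] assms(2)
    by (simp add: X_def algebra_simps)
  also have "\<dots> < 128 * real k * X"
  proof -
    have "65 * X < 64 * real k * X" using X1 assms(3) by (intro mult_strict_right_mono) auto
    moreover have "64 * (real k + 1) * X = 64 * real k * X + 64 * X" by (simp add: algebra_simps)
    moreover have "128 * real k * X = 64 * real k * X + 64 * real k * X" by simp
    ultimately show ?thesis using X1 by linarith
  qed
  also have "\<dots> = exp (7 * ln 2 + l + (\<sigma> * ln 4 + real v * ln (real s + 1)))"
  proof -
    have "7 * ln 2 = ln (128::real)" using ln_realpow[of "2::real" 7] by simp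
    moreover have "(real s + 1) ^ v = exp (real v * ln (real s + 1))"
      by (simp add: exp_of_nat_mult)
    ultimately show ?thesis unfolding X_def l_def exp_add powr_def using assms(3) by simp
  qed
  also have "\<dots> \<le> exp ((3 + 3.81 * L) * l)"
  proof -
    define Y Z where "Y = (4 * \<sigma> + 9 / 2) * (51 / 100)" and "Z = 7 * 25 / 36 + \<sigma> * (25 / 18)"
    have "\<sigma> * ln 4 \<le> \<sigma> * (25 / 18)"
      using ln2_le_25_over_36 ln_realpow[of "2::real" 2] \<sigma> by (intro mult_left_mono) auto
    then have "7 * ln 2 + \<sigma> * ln 4 \<le> Z" unfolding Z_def using ln2_le_25_over_36 by linarith
    moreover have "Z * 1 \<le> Z * (3 / 20 * l)"
      unfolding Z_def using ln_k \<sigma> by (intro mult_left_mono) auto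
    moreover have "real v * ln (real s + 1) \<le> (4 * \<sigma> + 9 / 2) * (51 / 100 * l)"
      using v ln_s1 \<sigma> by (intro mult_mono) auto
    then have "real v * ln (real s + 1) \<le> Y * l" unfolding Y_def by (simp only: mult.assoc)
    moreover have "(Z * (3 / 20) + 1 + Y) * l \<le> (3 + 3.81 * L) * l"
    proof -
      have "\<sigma> = 17 / 240 + 25 / 18 * L" by (simp add: \<sigma>_def field_simps)
      then have "Z * (3 / 20) + 1 + Y \<le> 3 + 3.81 * L"
        unfolding Y_def Z_def using L by (simp add: field_simps)
      then show ?thesis using ln_k by (intro mult_right_mono) auto
    qed
    moreover have "(Z * (3 / 20) + 1 + Y) * l = Z * (3 / 20 * l) + l + Y * l"
      by (simp add: distrib_right)
    ultimately show ?thesis unfolding exp_le_cancel_iff by linarith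
  qed
  also have "\<dots> = target (real k)"
    unfolding l_def L_def powr_def using assms(3) by simp
  finally show ?thesis .
qed

theorem mainTheorem3:
  fixes n k :: nat
  assumes "n > 1"
    and "card (prime_factors n) = k"
    and "k > 2"
  shows "real (jacobsthal n) < real k powr (3 + 3.81 * ln (ln (real k)))"
  using jacobsthal_small[of n k] jacobsthal_large[of n k] assms by (cases "k < 1024") auto

end
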